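(* Let $\Omega\in\mathbb{C}^{m\times m}$ be skew-Hermitian, and let $n\ge 0$ be an integer. Define $$\Theta_n(z)=\sum_{k=0}^n\binom{n}{k}\frac{(2n-k)!}{(2n)!}(2z)^k .$$ Then $$\mathcal{P}(\Theta_n(t\Omega))=e^{t\Omega}+O(t^{2n+1}).$$
   Context: For a full-rank matrix $A\in\mathbb{C}^{m\times p}$ ($m\ge p$), $\mathcal{P}(A)=U$ denotes the factor $U$ in the polar decomposition $A=UH$, where $U\in\mathbb{C}^{m\times p}$ has orthonormal columns ($U^*U=I$) and $H\in\mathbb{C}^{p\times p}$ is Hermitian positive-definite. Here $t$ is a real scalar and $O(\cdot)$ is understood in the Frobenius norm as $t\to 0$, with implied constant allowed to depend on the other data ($\Omega$, $n$, $m$); for $t$ sufficiently small $\Theta_n(t\Omega)$ is nonsingular, so $\mathcal{P}(\Theta_n(t\Omega))$ is defined. *)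

theory Defs
  imports "HOL-Analysis.Analysis" "HOL-Library.Landau_Symbols"
begin

text \<open>
  A complex \<open>m \<times> p\<close> matrix is an element of \<open>complex^'p^'m\<close>, with product \<open>**\<close> and identity
  \<open>mat 1\<close>. The operations \<open>*\<close>, \<open>^\<close> and \<open>1\<close> act componentwise on this type, and the library
  function \<open>exp\<close> is not available on it, so powers and the exponential are defined here.
\<close>

text \<open>The library norm of a matrix is the Frobenius norm.\<close>

lemma norm_matrix_eq_frobenius:
  fixes A :: "complex^'p^'m"
  shows "norm A = sqrt (\<Sum>i\<in>UNIV. \<Sum>j\<in>UNIV. (cmod (A $ i $ j))\<^sup>2)"
  by (simp add: norm_vec_def L2_set_def sum_nonneg)

definition conj_transpose :: "complex^'p^'m \<Rightarrow> complex^'m^'p" where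
  "conj_transpose A = transpose (map_matrix cnj A)"

definition hermitian :: "complex^'m^'m \<Rightarrow> bool" where
  "hermitian A \<longleftrightarrow> conj_transpose A = A"

definition skew_hermitian :: "complex^'m^'m \<Rightarrow> bool" where
  "skew_hermitian A \<longleftrightarrow> conj_transpose A = - A"

text \<open>For Hermitian \<open>H\<close> the form \<open>x\<^sup>* H x\<close> is real, hence equal to its real part.\<close>

definition hermitian_pos_def :: "complex^'m^'m \<Rightarrow> bool" where
  "hermitian_pos_def H \<longleftrightarrow>
     hermitian H \<and> (\<forall>x. x \<noteq> 0 \<longrightarrow> 0 < Re (\<Sum>i\<in>UNIV. cnj (x $ i) * (H *v x) $ i))"

definition is_polar_decomp ::
    "complex^'p^'m \<Rightarrow> complex^'p^'m \<Rightarrow> complex^'p^'p \<Rightarrow> bool" where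
  "is_polar_decomp A U H \<longleftrightarrow>
     A = U ** H \<and> conj_transpose U ** U = mat 1 \<and> hermitian_pos_def H"

text \<open>
  Such a factor \<open>U\<close> exists, and is then unique, exactly when \<open>A\<close> has full column rank;
  otherwise the value is unspecified.
\<close>

definition polar_factor :: "complex^'p^'m \<Rightarrow> complex^'p^'m" where
  "polar_factor A = (THE U. \<exists>H. is_polar_decomp A U H)"

primrec matrix_power :: "complex^'m^'m \<Rightarrow> nat \<Rightarrow> complex^'m^'m" where
  "matrix_power A 0 = mat 1"
| "matrix_power A (Suc k) = A ** matrix_power A k"

definition matrix_exp :: "complex^'m^'m \<Rightarrow> complex^'m^'m" where
  "matrix_exp A = (\<Sum>k. matrix_power A k /\<^sub>R fact k)"

definition Theta :: "nat \<Rightarrow> complex^'m^'m \<Rightarrow> complex^'m^'m" where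
  "Theta n Z =
     (\<Sum>k=0..n. (real (n choose k) * (fact (2 * n - k) / fact (2 * n))) *\<^sub>R
        matrix_power (2 *\<^sub>R Z) k)"

end

theory Submission
  imports Defs
begin

text \<open>
  A unitary diagonalization of \<open>\<Omega>\<close> (with imaginary eigenvalues) turns every matrix of the theorem
  into a function of \<open>\<Omega>\<close>: if \<open>\<Theta>\<^sub>n(t\<Omega>)\<close> has eigenvalues \<open>\<theta> \<noteq> 0\<close>, its polar factor has
  eigenvalues \<open>\<theta> / \<bar>\<theta>\<bar>\<close>. For imaginary \<open>z\<close> the number \<open>w = exp (- z) * \<Theta>\<^sub>n(z)\<close> is close to \<open>1\<close>, and
  twice its imaginary part equals in modulus the Pade error
  \<open>\<Theta>\<^sub>n(z) - exp (2 * z) * \<Theta>\<^sub>n(- z) = O(z\<^sup>2\<^sup>n\<^sup>+\<^sup>1)\<close>.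
\<close>

section \<open>The scalar Pade estimate\<close>

text \<open>The sum is the \<open>n\<close>-th backward difference of \<open>x choose m\<close> at
  \<open>x = N\<close>. By Pascal's rule each difference lowers both arguments of the binomial by
  one. The induction takes one more difference, between the values at \<open>N\<close> and
  \<open>N - 1\<close>.\<close>

lemma alternating_binomial_convolution:
  assumes "n \<le> N"
  shows "(\<Sum>j\<le>n. (-1) ^ j * int (n choose j) * int ((N - j) choose m)) =
    (if m < n then 0 else int ((N - n) choose (m - n)))"
  using assms
proof (induction n arbitrary: N)
  case 0
  then show ?case by simp
next
  case (Suc n)
  define g where "g N j = (-1) ^ j * int (n choose j) * int ((N - j) choose m)" for N j
  obtain M where N: "N = Suc M" and M: "n \<le> M"
    using Suc.prems by (cases N) auto
  have "(\<Sum>j\<le>Suc n. (-1) ^ j * int (Suc n choose j) * int ((N - j) choose m)) =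
      int (N choose m) + (\<Sum>j\<le>n. g N (Suc j) - g M j)"
    by (subst sum.atMost_Suc_shift, simp add: g_def N)
      (intro sum.cong refl, simp add: algebra_simps)
  also have "\<dots> = (\<Sum>j\<le>Suc n. g N j) - (\<Sum>j\<le>n. g M j)"
    by (subst sum.atMost_Suc_shift) (simp add: g_def sum_subtractf)
  also have "(\<Sum>j\<le>Suc n. g N j) = (\<Sum>j\<le>n. g N j)"
    by (simp add: g_def)
  also have "\<dots> = (if m < n then 0 else int ((N - n) choose (m - n)))"
    unfolding g_def using Suc.prems by (intro Suc.IH) simp
  also have "(\<Sum>j\<le>n. g M j) = (if m < n then 0 else int ((M - n) choose (m - n)))"
    unfolding g_def by (rule Suc.IH[OF M])
  finally have *: "(\<Sum>j\<le>Suc n. (-1) ^ j * int (Suc n choose j) * int ((N - j) choose m)) =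
      (if m < n then 0 else int ((N - n) choose (m - n)) - int ((M - n) choose (m - n)))"
    by simp
  \<comment> \<open>For \<open>m < n\<close> both terms vanish, and at \<open>m = n\<close> both
    binomials are \<open>1\<close> and cancel; beyond that Pascal's rule applies once more.\<close>
  show ?case
  proof (cases "m \<le> n")
    case True
    then show ?thesis using * by auto
  next
    case False
    then obtain l where "m - n = Suc l" "m - Suc n = l"
      by (metis Suc_diff_Suc not_le)
    moreover have "N - n = Suc (M - n)" "N - Suc n = M - n"
      using N M by auto
    ultimately show ?thesis using * False by simp
  qed
qed

definition Theta_coeff :: "nat \<Rightarrow> nat \<Rightarrow> real" where
  "Theta_coeff n k = real (n choose k) * (fact (2 * n - k) / fact (2 * n))"

definition Theta_scalar :: "nat \<Rightarrow> complex \<Rightarrow> complex" where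
  "Theta_scalar n z = (\<Sum>k=0..n. of_real (Theta_coeff n k) * (2 * z) ^ k)"

text \<open>This is the Pade order condition: the left side is the coefficient of
  \<open>x ^ k\<close> in \<open>exp x * Theta_scalar n (- x / 2)\<close>, the right side that in
  \<open>Theta_scalar n (x / 2)\<close>. With \<open>m = 2 * n - k\<close>, the quotient of
  \<open>(2n - j)!\<close> by \<open>(k - j)!\<close> is \<open>m!\<close> times a binomial, so the
  sum is an alternating convolution at \<open>N = 2 * n\<close>.\<close>

lemma Theta_coeff_exp_convolution:
  assumes "k \<le> 2 * n"
  shows "(\<Sum>j\<le>k. (-1) ^ j * Theta_coeff n j / fact (k - j)) = Theta_coeff n k"
proof -
  define m where "m = 2 * n - k"
  define c :: real where "c = fact m / fact (2 * n)"
  define g where "g j = (-1) ^ j * int (n choose j) * int ((2 * n - j) choose m)" for j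
  have "(-1) ^ j * Theta_coeff n j / fact (k - j) = c * of_int (g j)" if "j \<le> k" for j
  proof -
    have "m \<le> 2 * n - j" "2 * n - j - m = k - j"
      using that assms by (auto simp: m_def)
    then have "real ((2 * n - j) choose m) = fact (2 * n - j) / (fact m * fact (k - j))"
      by (simp add: binomial_fact)
    then show ?thesis
      by (simp add: Theta_coeff_def g_def c_def)
  qed
  then have "(\<Sum>j\<le>k. (-1) ^ j * Theta_coeff n j / fact (k - j)) = c * of_int (\<Sum>j\<le>k. g j)"
    by (simp add: sum_distrib_left)
  \<comment> \<open>For \<open>k < j \<le> 2 * n\<close> the upper entry \<open>2 * n - j\<close> is
    below \<open>m\<close>, so the added terms are zero.\<close>
  also have "(\<Sum>j\<le>k. g j) = (\<Sum>j\<le>2 * n. g j)"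
    using assms by (intro sum.mono_neutral_left) (auto simp: g_def m_def binomial_eq_0)
  also have "\<dots> = (\<Sum>j\<le>n. g j)"
    by (intro sum.mono_neutral_right) (auto simp: g_def)
  also have "\<dots> = (if m < n then 0 else int ((2 * n - n) choose (m - n)))"
    unfolding g_def by (rule alternating_binomial_convolution) simp
  also have "c * of_int \<dots> = Theta_coeff n k"
  proof (cases "k \<le> n")
    case True
    then have "m - n = n - k" "\<not> m < n" by (auto simp: m_def)
    then show ?thesis
      using binomial_symmetric[OF True] by (simp add: c_def Theta_coeff_def m_def)
  next
    case False
    then have "m < n" using assms by (auto simp: m_def)
    then show ?thesis using False by (simp add: Theta_coeff_def)
  qed
  finally show ?thesis .
qed

text \<open>Splitting off \<open>x ^ n\<close> leaves a convergent power series, whose sum is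
  continuous and hence bounded near \<open>0\<close>.\<close>

lemma has_fps_expansion_bigo:
  fixes f :: "'a :: {banach, real_normed_field} \<Rightarrow> 'a"
  assumes f: "f has_fps_expansion F" and F: "\<And>k. k < n \<Longrightarrow> fps_nth F k = 0"
  shows "f \<in> O[at 0](\<lambda>x. x ^ n)"
proof -
  define G where "G = fps_shift n F"
  have FG: "F = G * fps_X ^ n"
    using F by (auto simp: G_def fps_eq_iff fps_X_power_mult_right_nth)
  have conv: "fps_conv_radius G > 0"
    using f by (auto simp: G_def has_fps_expansion_def)
  have "((\<lambda>x. eval_fps G x) \<longlongrightarrow> eval_fps G 0) (at 0)"
    using has_fps_expansion_imp_continuous[OF eval_fps_has_fps_expansion[OF conv], of UNIV]
    by (simp add: continuous_within)
  then have "eval_fps G \<in> O[at 0](\<lambda>_. 1)"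
    by (intro bigoI_tendsto[where c = "eval_fps G 0"]) auto
  then have bigo: "(\<lambda>x. eval_fps G x * x ^ n) \<in> O[at 0](\<lambda>x. 1 * x ^ n)"
    by (intro landau_o.big.mult) auto
  have "(\<lambda>x. eval_fps G x * x ^ n) has_fps_expansion F"
    unfolding FG by (intro fps_expansion_intros eval_fps_has_fps_expansion conv)
  then have "eventually (\<lambda>x. eval_fps F x = eval_fps G x * x ^ n) (at 0)"
    by (auto simp: has_fps_expansion_def eventually_at_filter elim: eventually_mono)
  moreover have "eventually (\<lambda>x. eval_fps F x = f x) (at 0)"
    using f by (auto simp: has_fps_expansion_def eventually_at_filter elim: eventually_mono)
  ultimately have "eventually (\<lambda>x. f x = eval_fps G x * x ^ n) (at 0)"
    by eventually_elim simp
  then show ?thesis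
    using bigo by (subst landau_o.big.in_cong) auto
qed

text \<open>\<open>Theta_scalar n (x / 2)\<close> is the numerator of the \<open>[n/n]\<close> Pade approximant of \<open>exp x\<close>.\<close>

lemma Theta_scalar_pade:
  "(\<lambda>x. Theta_scalar n (x / 2) - exp x * Theta_scalar n (- x / 2)) \<in> O[at 0](\<lambda>x. x ^ (2 * n + 1))"
proof (rule has_fps_expansion_bigo)
  define a :: "nat \<Rightarrow> complex" where "a k = of_real (Theta_coeff n k)" for k
  define F where "F = (\<Sum>k=0..n. fps_const (a k) * fps_X ^ k)"
  define G where "G = (\<Sum>k=0..n. fps_const ((-1) ^ k * a k) * fps_X ^ k)"
  \<comment> \<open>This holds for every \<open>k\<close>: beyond degree \<open>n\<close> the factor
    \<open>n choose k\<close> makes \<open>a k\<close> zero.\<close>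
  have F_nth: "fps_nth F k = a k" for k
    by (simp add: F_def fps_sum_nth fps_X_power_nth if_distrib[of "\<lambda>x. _ * x"] sum.delta'
        cong: if_cong) (simp add: a_def Theta_coeff_def)
  have G_nth: "fps_nth G k = (-1) ^ k * a k" for k
    by (simp add: G_def fps_sum_nth fps_X_power_nth if_distrib[of "\<lambda>x. _ * x"] sum.delta'
        cong: if_cong) (simp add: a_def Theta_coeff_def)
  have "(\<lambda>x. (\<Sum>k=0..n. a k * x ^ k) - exp x * (\<Sum>k=0..n. ((-1) ^ k * a k) * x ^ k))
      has_fps_expansion F - fps_exp 1 * G"
    unfolding F_def G_def by (intro fps_expansion_intros)
  moreover have "Theta_scalar n (- x / 2) = (\<Sum>k=0..n. ((-1) ^ k * a k) * x ^ k)" for x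
    by (simp add: Theta_scalar_def a_def power_minus[of x] mult_ac)
  ultimately show "(\<lambda>x. Theta_scalar n (x / 2) - exp x * Theta_scalar n (- x / 2))
      has_fps_expansion F - fps_exp 1 * G"
    by (simp add: Theta_scalar_def a_def)
  fix k assume "k < 2 * n + 1"
  then have k: "k \<le> 2 * n" by simp
  have "fps_nth (fps_exp 1 * G) k = fps_nth (G * fps_exp 1) k"
    by (simp add: mult.commute)
  also have "\<dots> = of_real (\<Sum>j\<le>k. (-1) ^ j * Theta_coeff n j / fact (k - j))"
    by (simp add: fps_mult_nth G_nth a_def atLeast0AtMost)
  also have "\<dots> = fps_nth F k"
    using Theta_coeff_exp_convolution[OF k] by (simp add: F_nth a_def)
  finally show "fps_nth (F - fps_exp 1 * G) k = 0"
    by simp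
qed

section \<open>The phase of \<open>Theta_scalar\<close> on the imaginary axis\<close>

lemma cnj_Theta_scalar: "cnj (Theta_scalar n z) = Theta_scalar n (cnj z)"
  by (simp add: Theta_scalar_def)

lemma tendsto_Theta_scalar:
  assumes "(f \<longlongrightarrow> 0) F"
  shows "((\<lambda>x. Theta_scalar n (f x)) \<longlongrightarrow> 1) F"
proof -
  have "isCont (Theta_scalar n) 0"
    unfolding Theta_scalar_def by (intro continuous_intros)
  moreover have "Theta_scalar n 0 = 1"
    by (simp add: Theta_scalar_def power_0_left if_distrib[of "\<lambda>x. _ * x"] Theta_coeff_def
        cong: if_cong)
  ultimately show ?thesis
    using isCont_tendsto_compose[OF _ assms, of "Theta_scalar n"] by simp
qed

text \<open>For a unit \<open>u\<close> with \<open>0 \<le> Re u\<close>, the square of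
  \<open>1 - Re u\<close> is at most \<open>(1 - Re u) * (1 + Re u)\<close>, the square of
  \<open>Im u\<close>. This would give the factor \<open>sqrt 2\<close>; the constant
  \<open>2\<close> avoids the root.\<close>

lemma cmod_sgn_minus_one_le:
  assumes "0 \<le> Re w" "w \<noteq> 0"
  shows "cmod (sgn w - 1) \<le> 2 * \<bar>Im w\<bar> / cmod w"
proof -
  define u where "u = sgn w"
  have u: "cmod u = 1" "0 \<le> Re u"
    using assms by (auto simp: u_def norm_sgn complex_sgn_def)
  have *: "(Re u)\<^sup>2 + (Im u)\<^sup>2 = 1"
    using u(1) by (simp add: cmod_def)
  have "Re u \<le> 1"
    using abs_Re_le_cmod[of u] u by simp
  then have "0 \<le> (1 - Re u) * Re u"
    using u by simp
  then have "(1 - Re u)\<^sup>2 + (Im u)\<^sup>2 \<le> 2 * (Im u)\<^sup>2"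
    using * by (simp add: power2_eq_square algebra_simps)
  then have "(1 - Re u)\<^sup>2 + (Im u)\<^sup>2 \<le> 4 * (Im u)\<^sup>2"
    by (rule order_trans) simp
  then have "(cmod (u - 1))\<^sup>2 \<le> (2 * \<bar>Im u\<bar>)\<^sup>2"
    by (simp add: cmod_power2 power_mult_distrib power2_commute)
  then have "cmod (u - 1) \<le> 2 * \<bar>Im u\<bar>"
    by (rule power2_le_imp_le) simp
  then show ?thesis
    using assms by (simp add: u_def complex_sgn_def divide_inverse abs_mult mult_ac)
qed

text \<open>As \<open>exp z\<close> has modulus \<open>1\<close> and \<open>sgn\<close> is
  multiplicative, the error is the distance of \<open>sgn w\<close> from \<open>1\<close>, which
  \<open>Im w\<close> controls; the Pade estimate in turn controls \<open>Im w\<close>.\<close>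

lemma sgn_Theta_scalar_bigo:
  fixes r :: real
  shows "(\<lambda>t. cmod (sgn (Theta_scalar n (of_real t * (\<i> * r))) - exp (of_real t * (\<i> * r))))
    \<in> O[at 0](\<lambda>t::real. t ^ (2 * n + 1))"
proof -
  define z :: "real \<Rightarrow> complex" where "z t = of_real t * (\<i> * r)" for t
  define w where "w t = exp (- z t) * Theta_scalar n (z t)" for t
  have z_lim: "(z \<longlongrightarrow> 0) (at 0)"
    unfolding z_def by (auto intro!: tendsto_eq_intros)
  have "((\<lambda>t. exp (- z t)) \<longlongrightarrow> exp (- 0)) (at 0)"
    by (intro tendsto_intros z_lim)
  then have w_lim: "(w \<longlongrightarrow> 1) (at 0)"
    unfolding w_def using tendsto_mult[OF _ tendsto_Theta_scalar[OF z_lim]] by fastforce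
  \<comment> \<open>The bound \<open>1/2\<close> keeps \<open>w\<close> in the right half-plane and
    away from \<open>0\<close>.\<close>
  have Rew: "eventually (\<lambda>t. Re (w t) > 1/2) (at 0)"
    using tendsto_Re[OF w_lim] by (rule order_tendstoD) simp
  \<comment> \<open>Since \<open>cnj (z t) = - z t\<close>, multiplying \<open>w - cnj w\<close> by
    \<open>exp z\<close> gives the Pade error at \<open>x = 2 * z t\<close>; the factor
    \<open>exp z\<close> does not change the modulus.\<close>
  have imw: "2 * \<bar>Im (w t)\<bar> =
      cmod (Theta_scalar n (2 * z t / 2) - exp (2 * z t) * Theta_scalar n (- (2 * z t) / 2))" for t
  proof -
    have cz: "cnj (z t) = - z t"
      by (simp add: z_def)
    have nz: "cmod (exp (z t)) = 1"
      by (simp add: z_def)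
    have "exp (z t) * w t = Theta_scalar n (z t)"
      by (simp add: w_def exp_minus)
    moreover have "exp (z t) * cnj (w t) = exp (2 * z t) * Theta_scalar n (- z t)"
      by (simp add: w_def cnj_Theta_scalar exp_cnj cz mult_exp_exp flip: mult.assoc)
    ultimately have "cmod (Theta_scalar n (2 * z t / 2)
        - exp (2 * z t) * Theta_scalar n (- (2 * z t) / 2)) = cmod (exp (z t) * (w t - cnj (w t)))"
      by (simp add: algebra_simps)
    also have "\<dots> = cmod (w t - cnj (w t))"
      by (simp only: norm_mult nz mult_1)
    also have "\<dots> = 2 * \<bar>Im (w t)\<bar>"
      by (simp add: complex_diff_cnj norm_mult)
    finally show ?thesis ..
  qed
  have "(\<lambda>t. Im (w t)) \<in> O[at 0](\<lambda>t::real. t ^ (2 * n + 1))"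
  \<comment> \<open>The filter \<open>at 0\<close> excludes the point \<open>0\<close>, so composing
    with \<open>2 * z t\<close> requires \<open>r \<noteq> 0\<close>.\<close>
  proof (cases "r = 0")
    case True
    then have "Im (w t) = 0" for t
      using imw[of t] by (simp add: z_def)
    then show ?thesis by simp
  next
    case False
    have "filterlim (\<lambda>t. 2 * z t) (at 0) (at 0)"
      using False tendsto_mult_right_zero[OF z_lim, of 2]
      by (auto simp: filterlim_at z_def eventually_at_filter)
    from landau_o.big.compose[OF Theta_scalar_pade this, of n]
    have "(\<lambda>t. Theta_scalar n (2 * z t / 2) - exp (2 * z t) * Theta_scalar n (- (2 * z t) / 2))
        \<in> O[at 0](\<lambda>t. (2 * z t) ^ (2 * n + 1))" .
    then have "(\<lambda>t. 2 * \<bar>Im (w t)\<bar>) \<in> O[at 0](\<lambda>t. cmod ((2 * z t) ^ (2 * n + 1)))"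
      unfolding imw by simp
    also have "(\<lambda>t. cmod ((2 * z t) ^ (2 * n + 1))) =
        (\<lambda>t. (2 * \<bar>r\<bar>) ^ (2 * n + 1) * \<bar>t ^ (2 * n + 1)\<bar>)"
      by (simp add: fun_eq_iff norm_power norm_mult z_def power_mult_distrib power_abs abs_mult)
    also have "O[at 0](\<dots>) = O[at 0](\<lambda>t. t ^ (2 * n + 1))"
      using False by simp
    finally show ?thesis by simp
  qed
  moreover have "(\<lambda>t. cmod (sgn (Theta_scalar n (z t)) - exp (z t))) \<in> O[at 0](\<lambda>t. Im (w t))"
  \<comment> \<open>The constant is \<open>2 / (1/2)\<close>: the factor from
    \<open>cmod_sgn_minus_one_le\<close> over the lower bound for \<open>cmod (w t)\<close>.\<close>
  proof (rule bigoI[where c = 4], use Rew in eventually_elim)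
    case (elim t)
    have nz: "cmod (exp (z t)) = 1"
      by (simp add: z_def)
    have "Theta_scalar n (z t) = exp (z t) * w t"
      by (simp add: w_def exp_minus)
    moreover have "sgn (exp (z t)) = exp (z t)"
      using nz by (simp add: sgn_div_norm)
    ultimately have "sgn (Theta_scalar n (z t)) - exp (z t) = exp (z t) * (sgn (w t) - 1)"
      by (simp add: sgn_mult algebra_simps)
    then have "cmod (sgn (Theta_scalar n (z t)) - exp (z t)) = cmod (sgn (w t) - 1)"
      by (simp only: norm_mult nz mult_1)
    also have "\<dots> \<le> 2 * \<bar>Im (w t)\<bar> / cmod (w t)"
      using elim by (intro cmod_sgn_minus_one_le) auto
    also have "\<dots> \<le> 2 * \<bar>Im (w t)\<bar> / (1 / 2)"
      using elim complex_Re_le_cmod[of "w t"] by (intro divide_left_mono) auto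
    finally show ?case by simp
  qed
  ultimately show ?thesis
    unfolding z_def using landau_o.big_trans by blast
qed

section \<open>Hermitian matrices and polar factors\<close>

text \<open>Conjugate-linear in the first argument, so that its real part is the real inner product
  \<open>\<bullet>\<close> of the type.\<close>

definition cinner :: "complex^'m \<Rightarrow> complex^'m \<Rightarrow> complex" where
  "cinner x y = (\<Sum>i\<in>UNIV. cnj (x $ i) * y $ i)"

lemma Re_cinner: "Re (cinner x y) = x \<bullet> y"
  by (simp add: cinner_def inner_vec_def inner_complex_def)

lemma cinner_commute: "cinner y x = cnj (cinner x y)"
  by (simp add: cinner_def mult.commute)

lemma cinner_self: "cinner x x = of_real ((norm x)\<^sup>2)"
proof (rule complex_eqI)
  have "Im (cinner x x) = - Im (cinner x x)"
    by (subst cinner_commute) simp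
  then show "Im (cinner x x) = Im (of_real ((norm x)\<^sup>2))"
    by simp
qed (simp add: Re_cinner power2_norm_eq_inner)

lemma cinner_diff_right: "cinner x (y - z) = cinner x y - cinner x z"
  by (simp add: cinner_def right_diff_distrib sum_subtractf)

lemma cinner_add_right: "cinner x (y + z) = cinner x y + cinner x z"
  by (simp add: cinner_def distrib_left sum.distrib)

lemma cinner_scaleR_right: "cinner x (r *\<^sub>R y) = r *\<^sub>R cinner x y"
  by (simp add: cinner_def scaleR_sum_right)

lemma cinner_vector_scalar_right: "cinner x (c *s y) = c * cinner x y"
  by (simp add: cinner_def vector_scalar_mult_def sum_distrib_left mult_ac)

lemma cinner_sum_right: "cinner x (sum f S) = (\<Sum>s\<in>S. cinner x (f s))"
  by (induction S rule: infinite_finite_induct) (auto simp: cinner_add_right, auto simp: cinner_def)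

lemma matrix_vector_mult_scaleR_complex:
  fixes A :: "complex^'n^'m"
  shows "A *v (r *\<^sub>R x) = r *\<^sub>R (A *v x)"
  by (rule linear_scale) simp

lemma conj_transpose_nth [simp]: "conj_transpose A $ i $ j = cnj (A $ j $ i)"
  by (simp add: conj_transpose_def transpose_def)

lemma cinner_matrix_left: "cinner (A *v x) y = cinner x (conj_transpose A *v y)"
proof -
  have "cinner (A *v x) y = (\<Sum>i\<in>UNIV. \<Sum>j\<in>UNIV. cnj (A $ i $ j) * cnj (x $ j) * y $ i)"
    by (simp add: cinner_def matrix_vector_mult_def sum_distrib_right)
  also have "\<dots> = (\<Sum>j\<in>UNIV. \<Sum>i\<in>UNIV. cnj (A $ i $ j) * cnj (x $ j) * y $ i)"
    by (rule sum.swap)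
  also have "\<dots> = cinner x (conj_transpose A *v y)"
    by (simp add: cinner_def matrix_vector_mult_def sum_distrib_left mult_ac)
  finally show ?thesis .
qed

lemma conj_transpose_mult:
  "conj_transpose (A ** B) = conj_transpose B ** conj_transpose A"
  by (simp add: vec_eq_iff matrix_matrix_mult_def mult.commute)

lemma hermitian_pos_def_iff:
  "hermitian_pos_def H \<longleftrightarrow> hermitian H \<and> (\<forall>x. x \<noteq> 0 \<longrightarrow> 0 < x \<bullet> (H *v x))"
  by (simp add: hermitian_pos_def_def flip: cinner_def Re_cinner)

text \<open>\<open>Re (trace (D ** H ** D))\<close> is the sum of the quadratic form of \<open>H\<close> over the columns of \<open>D\<close>.\<close>

lemma hermitian_pos_def_trace:
  assumes H: "hermitian_pos_def H" and D: "hermitian D"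
  shows "0 \<le> Re (trace (D ** H ** D))"
    and "Re (trace (D ** H ** D)) = 0 \<Longrightarrow> D = 0"
proof -
  define q where "q i = column i D \<bullet> (H *v column i D)" for i
  have D_nth: "cnj (D $ k $ i) = D $ i $ k" for i k
    using D by (metis conj_transpose_nth hermitian_def)
  have "trace (D ** H ** D) = trace (D ** (H ** D))"
    by (simp add: matrix_mul_assoc)
  also have "\<dots> = (\<Sum>i\<in>UNIV. cinner (column i D) (H *v column i D))"
    by (simp add: trace_def matrix_matrix_mult_def cinner_def column_def matrix_vector_mult_def D_nth)
  finally have tr: "Re (trace (D ** H ** D)) = (\<Sum>i\<in>UNIV. q i)"
    by (simp add: Re_cinner q_def)
  have q_nonneg: "0 \<le> q i" and q_0: "q i = 0 \<Longrightarrow> column i D = 0" for i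
    using H by (cases "column i D = 0"; force simp: q_def hermitian_pos_def_iff)+
  show "0 \<le> Re (trace (D ** H ** D))"
    unfolding tr by (intro sum_nonneg q_nonneg)
  assume "Re (trace (D ** H ** D)) = 0"
  then have "column i D = 0" for i
    unfolding tr using q_nonneg q_0 by (simp add: sum_nonneg_eq_0_iff)
  then show "D = 0"
    by (simp add: vec_eq_iff column_def)
qed

text \<open>With \<open>D = H - K\<close>, the equation \<open>H ** H = K ** K\<close> reads \<open>H ** D + D ** K = 0\<close>; multiplying
  by \<open>D\<close> and taking traces gives two nonnegative terms with sum \<open>0\<close>.\<close>

lemma hermitian_pos_def_sqrt_unique:
  assumes H: "hermitian_pos_def H" and K: "hermitian_pos_def K" and eq: "H ** H = K ** K"
  shows "H = K"
proof -
  define D where "D = H - K"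
  have herm: "hermitian D"
    using H K by (simp add: D_def hermitian_pos_def_def hermitian_def vec_eq_iff)
  have "H ** D + D ** K = 0"
    using eq by (simp add: D_def vec_eq_iff matrix_matrix_mult_def algebra_simps sum_subtractf)
  then have "trace (D ** (H ** D)) + trace (D ** (D ** K)) = trace (D ** 0)"
    by (simp flip: trace_add matrix_add_ldistrib)
  also have "trace (D ** (D ** K)) = trace (D ** K ** D)"
    by (simp add: trace_mul_sym[of D])
  finally have "trace (D ** H ** D) + trace (D ** K ** D) = 0"
    by (simp add: matrix_mul_assoc) (simp add: trace_def matrix_matrix_mult_def)
  then have "Re (trace (D ** H ** D)) + Re (trace (D ** K ** D)) = 0"
    by (metis plus_complex.sel(1) zero_complex.sel(1))
  then have "Re (trace (D ** H ** D)) = 0"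
    using hermitian_pos_def_trace(1)[OF H herm] hermitian_pos_def_trace(1)[OF K herm] by linarith
  then have "D = 0"
    using hermitian_pos_def_trace(2)[OF H herm] by simp
  then show ?thesis
    by (simp add: D_def)
qed

lemma hermitian_pos_def_invertible:
  assumes "hermitian_pos_def H"
  shows "invertible H"
proof -
  have "x = 0" if "H *v x = 0" for x
    using assms that by (force simp: hermitian_pos_def_iff)
  then show ?thesis
    using matrix_left_invertible_ker[of H] invertible_left_inverse[of H] by auto
qed

text \<open>Every polar decomposition of \<open>A\<close> satisfies
  \<open>conj_transpose A ** A = H ** H\<close>, so uniqueness of positive definite square roots
  fixes \<open>H\<close>; cancelling the invertible \<open>H\<close> then fixes the other
  factor.\<close>

lemma polar_factor_eqI:
  assumes "is_polar_decomp A U H"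
  shows "polar_factor A = U"
  unfolding polar_factor_def
proof (rule the_equality)
  show "\<exists>H. is_polar_decomp A U H"
    using assms by blast
next
  fix V assume "\<exists>K. is_polar_decomp A V K"
  then obtain K where K: "is_polar_decomp A V K" by blast
  have sq: "conj_transpose A ** A = G ** G" if "is_polar_decomp A W G" for W G
  proof -
    have "A = W ** G"
      using that by (simp add: is_polar_decomp_def)
    then have "conj_transpose A ** A = conj_transpose G ** (conj_transpose W ** W) ** G"
      by (simp add: conj_transpose_mult matrix_mul_assoc)
    also have "\<dots> = G ** G"
      using that by (simp add: is_polar_decomp_def hermitian_pos_def_def hermitian_def)
    finally show ?thesis .
  qed
  have "H = K"
  proof (rule hermitian_pos_def_sqrt_unique)
    show "hermitian_pos_def H" "hermitian_pos_def K"
      using assms K by (simp_all add: is_polar_decomp_def)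
    show "H ** H = K ** K"
      using sq[OF assms] sq[OF K] by simp
  qed
  obtain L where "H ** L = mat 1"
    using assms hermitian_pos_def_invertible[of H] by (auto simp: is_polar_decomp_def invertible_def)
  moreover have "V ** H = U ** H"
    using assms K \<open>H = K\<close> by (metis is_polar_decomp_def)
  ultimately show "V = U"
    by (metis matrix_mul_assoc matrix_mul_rid)
qed

section \<open>The spectral theorem for Hermitian matrices\<close>

text \<open>The maximum \<open>\<mu>\<close> of the Rayleigh quotient on \<open>V\<close> makes \<open>A - \<mu>\<close> negative semidefinite on \<open>V\<close>;
  a semidefinite form vanishes at \<open>x\<close> only if its gradient does.\<close>

lemma hermitian_eigenvector_in_subspace:
  fixes A :: "complex^'m^'m"
  assumes A: "hermitian A" and V: "subspace V" and inv: "\<And>x. x \<in> V \<Longrightarrow> A *v x \<in> V"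
    and nz: "z \<in> V" "z \<noteq> 0"
  obtains x \<mu> where "x \<in> V" "norm x = 1" "A *v x = \<mu> *\<^sub>R x"
proof -
  define f where "f x = x \<bullet> (A *v x)" for x
  have sa: "(A *v x) \<bullet> y = x \<bullet> (A *v y)" for x y
    using A cinner_matrix_left[of A x y] by (simp add: hermitian_def flip: Re_cinner)
  have "compact (V \<inter> sphere 0 1)"
    by (simp add: closed_subspace V closed_Int_compact)
  moreover have "(inverse (norm z)) *\<^sub>R z \<in> V \<inter> sphere 0 1"
    using nz V by (simp add: subspace_scale)
  moreover have "continuous_on (V \<inter> sphere 0 1) f"
    unfolding f_def
    by (intro continuous_intros bounded_linear.continuous_on[OF matrix_vector_mul_bounded_linear])
  ultimately obtain x where "x \<in> V \<inter> sphere 0 1" and max: "\<And>y. y \<in> V \<inter> sphere 0 1 \<Longrightarrow> f y \<le> f x"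
    using continuous_attains_sup[of "V \<inter> sphere 0 1" f] by blast
  then have x: "x \<in> V" "norm x = 1"
    by auto
  define \<mu> where "\<mu> = f x"
  define B where "B y = A *v y - \<mu> *\<^sub>R y" for y
  have B_add: "B (u + r *\<^sub>R w) = B u + r *\<^sub>R B w" for u w r
    by (simp add: B_def algebra_simps matrix_vector_mult_scaleR_complex)
  have BV: "B y \<in> V" if "y \<in> V" for y
    unfolding B_def using V inv that by (simp add: subspace_diff subspace_scale)
  have neg: "y \<bullet> B y \<le> 0" if "y \<in> V" for y
  proof (cases "y = 0")
    case False
    define u where "u = (inverse (norm y)) *\<^sub>R y"
    have "f u \<le> \<mu>"
      unfolding \<mu>_def u_def using False that V by (intro max) (simp add: subspace_scale)
    moreover have "y = norm y *\<^sub>R u"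
      using False by (simp add: u_def)
    then have "f y = (norm y)\<^sup>2 * f u"
      by (metis (no_types, lifting) f_def inner_scaleR_left inner_scaleR_right
          matrix_vector_mult_scaleR_complex mult.assoc power2_eq_square)
    ultimately have "f y \<le> (norm y)\<^sup>2 * \<mu>"
      by (simp add: mult_left_mono)
    then show ?thesis
      by (simp add: B_def f_def inner_diff_right power2_norm_eq_inner mult.commute)
  qed simp
  \<comment> \<open>The residual \<open>w\<close> is the gradient direction at the maximizer; moving
    from \<open>x\<close> along it would make the form positive unless \<open>w = 0\<close>.\<close>
  define w where "w = B x"
  have w: "w \<in> V"
    using BV x by (simp add: w_def)
  have xw: "x \<bullet> w = 0"
    using x by (simp add: w_def B_def inner_diff_right \<mu>_def f_def flip: power2_norm_eq_inner)
  \<comment> \<open>\<open>A\<close>, and so \<open>B\<close>, is self-adjoint for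
    \<open>\<bullet>\<close>, which moves \<open>B\<close> onto \<open>x\<close>.\<close>
  have xBw: "x \<bullet> B w = w \<bullet> w"
    by (simp add: B_def w_def inner_diff_left inner_diff_right sa matrix_vector_mult_diff_distrib
        matrix_vector_mult_scaleR_complex)
  have "w \<bullet> w = 0"
  proof (rule ccontr)
    assume "w \<bullet> w \<noteq> 0"
    then have pos: "w \<bullet> w > 0" by (simp add: order_less_le)
    define b where "b = - (w \<bullet> B w)"
    have b: "b \<ge> 0" using neg[OF w] by (simp add: b_def)
    have quad: "2 * r * (w \<bullet> w) - r\<^sup>2 * b \<le> 0" for r
    proof -
      have "(x + r *\<^sub>R w) \<bullet> B (x + r *\<^sub>R w) \<le> 0"
        using neg x w V by (simp add: subspace_add subspace_scale)
      then show ?thesis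
        by (simp add: B_add inner_add_left inner_add_right xw xBw b_def power2_eq_square
            w_def[symmetric] algebra_simps)
    qed
    \<comment> \<open>This step is short enough for the linear term to beat the quadratic one:
      \<open>r * b < w \<bullet> w\<close>. The \<open>+ 1\<close> covers
      \<open>b = 0\<close>.\<close>
    define r where "r = (w \<bullet> w) / (b + 1)"
    have r: "r > 0" "r * b < w \<bullet> w"
      using pos b by (auto simp: r_def field_simps)
    have "r * (r * b) < r * (w \<bullet> w)"
      using r by (simp add: mult_strict_left_mono)
    moreover have "0 < r * (w \<bullet> w)" using r pos by simp
    ultimately show False
      using quad[of r] by (simp add: power2_eq_square algebra_simps)
  qed
  then have "A *v x = \<mu> *\<^sub>R x"
    by (simp add: w_def B_def)
  with x show ?thesis by (rule that)
qed

text \<open>The orthogonal complement of the eigenvectors already found is invariant under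
  \<open>A\<close>, and nonzero while fewer than \<open>CARD('m)\<close> are found, so it contains a
  further one.\<close>

lemma hermitian_orthonormal_eigenvectors:
  fixes A :: "complex^'m^'m"
  assumes A: "hermitian A" and "k \<le> CARD('m)"
  shows "\<exists>S. finite S \<and> card S = k \<and> (\<forall>x\<in>S. norm x = 1 \<and> (\<exists>\<mu>::real. A *v x = \<mu> *\<^sub>R x)) \<and>
    (\<forall>x\<in>S. \<forall>y\<in>S. x \<noteq> y \<longrightarrow> cinner x y = 0)"
  using \<open>k \<le> CARD('m)\<close>
proof (induction k)
  case 0
  show ?case by (intro exI[of _ "{}"]) simp
next
  case (Suc k)
  then obtain S where S: "finite S" "card S = k"
    and eig: "\<And>x. x \<in> S \<Longrightarrow> norm x = 1 \<and> (\<exists>\<mu>::real. A *v x = \<mu> *\<^sub>R x)"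
    and orth: "\<And>x y. x \<in> S \<Longrightarrow> y \<in> S \<Longrightarrow> x \<noteq> y \<Longrightarrow> cinner x y = 0"
    by fastforce
  define V where "V = {x. \<forall>s\<in>S. cinner s x = 0}"
  have V: "subspace V"
    by (auto simp: subspace_def V_def cinner_add_right cinner_scaleR_right) (simp add: cinner_def)
  have inv: "A *v x \<in> V" if "x \<in> V" for x
  proof -
    have "cinner s (A *v x) = 0" if s: "s \<in> S" for s
    proof -
      obtain \<mu> :: real where \<mu>: "A *v s = \<mu> *\<^sub>R s"
        using eig[OF s] by blast
      have "cinner s (A *v x) = cinner (A *v s) x"
        using A by (simp add: cinner_matrix_left hermitian_def)
      also have "\<dots> = cnj (\<mu> *\<^sub>R cinner x s)"
        by (subst cinner_commute) (simp add: \<mu> cinner_scaleR_right)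
      also have "\<dots> = 0"
        using \<open>x \<in> V\<close> s by (subst cinner_commute) (simp add: V_def)
      finally show ?thesis .
    qed
    then show ?thesis by (simp add: V_def)
  qed
  \<comment> \<open>Otherwise every \<open>x\<close> equals its orthogonal projection
    \<open>p\<close> onto the complex span of \<open>S\<close>, and the dimension would be at most
    \<open>k\<close>.\<close>
  have "\<exists>z\<in>V. z \<noteq> 0"
  proof (rule ccontr)
    assume no: "\<not> (\<exists>z\<in>V. z \<noteq> 0)"
    have "x \<in> vec.span S" for x
    proof -
      define p where "p = (\<Sum>s\<in>S. cinner s x *s s)"
      have "cinner s p = cinner s x" if "s \<in> S" for s
      proof -
        have "cinner s p = (\<Sum>t\<in>S. if t = s then cinner s x else 0)"
          unfolding p_def cinner_sum_right cinner_vector_scalar_right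
          using orth that eig by (intro sum.cong) (auto simp: cinner_self)
        then show ?thesis using that S by simp
      qed
      then have "x - p \<in> V"
        by (simp add: V_def cinner_diff_right)
      then have "x = p" using no by auto
      moreover have "p \<in> vec.span S"
        unfolding p_def by (intro vec.span_sum vec.span_scale vec.span_base)
      ultimately show ?thesis by simp
    qed
    then have "vec.dim (UNIV :: (complex^'m) set) \<le> card S"
      using S by (intro vec.dim_le_card) auto
    then show False using Suc.prems S by (simp add: card_cart_basis)
  qed
  then obtain z where "z \<in> V" "z \<noteq> 0" by blast
  then obtain x \<mu> where x: "x \<in> V" "norm x = 1" "A *v x = \<mu> *\<^sub>R x"
    using hermitian_eigenvector_in_subspace[OF A V inv] by metis
  have xS: "cinner s x = 0" "cinner x s = 0" if "s \<in> S" for s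
    using x that by (auto simp: V_def cinner_commute[of x])
  have "x \<notin> S" using xS(1)[of x] x by (auto simp: cinner_self)
  then show ?case
    using S eig orth x xS by (intro exI[of _ "insert x S"]) auto
qed

definition diagonal_matrix :: "('m \<Rightarrow> complex) \<Rightarrow> complex^'m^'m" where
  "diagonal_matrix d = (\<chi> i j. if i = j then d i else 0)"

text \<open>The columns of \<open>Q\<close> are the eigenvectors: orthonormality makes
  \<open>Q\<close> unitary, and the eigenvalue equations read \<open>A ** Q = Q ** D\<close> with
  \<open>D\<close> diagonal.\<close>

lemma hermitian_spectral:
  fixes A :: "complex^'m^'m"
  assumes A: "hermitian A"
  obtains Q and d :: "'m \<Rightarrow> real" where "conj_transpose Q ** Q = mat 1"
    "A = Q ** diagonal_matrix (\<lambda>j. of_real (d j)) ** conj_transpose Q"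
proof -
  obtain S :: "(complex^'m) set" where S: "finite S" "card S = CARD('m)"
    and eig: "\<forall>x\<in>S. norm x = 1 \<and> (\<exists>\<mu>::real. A *v x = \<mu> *\<^sub>R x)"
    and orth: "\<forall>x\<in>S. \<forall>y\<in>S. x \<noteq> y \<longrightarrow> cinner x y = 0"
    using hermitian_orthonormal_eigenvectors[OF A order_refl] by blast
  obtain v where v: "bij_betw v (UNIV :: 'm set) S"
    using S finite_same_card_bij[of "UNIV :: 'm set" S] by auto
  have vS: "v j \<in> S" for j
    using v by (auto simp: bij_betw_def)
  have inj: "v i = v j \<longleftrightarrow> i = j" for i j
    using v by (auto simp: bij_betw_def inj_on_def)
  have "\<forall>j. \<exists>\<mu>::real. A *v v j = \<mu> *\<^sub>R v j"
    using eig vS by blast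
  then obtain d :: "'m \<Rightarrow> real" where d: "\<And>j. A *v v j = d j *\<^sub>R v j"
    by (auto dest!: choice)
  define Q :: "complex^'m^'m" where "Q = (\<chi> i j. v j $ i)"
  have Q: "conj_transpose Q ** Q = mat 1"
  proof -
    have "(conj_transpose Q ** Q) $ i $ j = cinner (v i) (v j)" for i j
      by (simp add: Q_def matrix_matrix_mult_def cinner_def)
    moreover have "cinner (v i) (v j) = (if i = j then 1 else 0)" for i j
      using orth eig vS[of i] vS[of j] inj[of i j] by (auto simp: cinner_self)
    ultimately show ?thesis
      by (simp add: vec_eq_iff mat_def)
  qed
  then have Q': "Q ** conj_transpose Q = mat 1"
    by (simp add: matrix_left_right_inverse)
  have "(A ** Q) $ i $ j = (Q ** diagonal_matrix (\<lambda>j. of_real (d j))) $ i $ j" for i j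
  proof -
    have "(A ** Q) $ i $ j = (A *v v j) $ i"
      by (simp add: Q_def matrix_matrix_mult_def matrix_vector_mult_def)
    also have "\<dots> = (Q ** diagonal_matrix (\<lambda>j. of_real (d j))) $ i $ j"
      by (simp add: d Q_def matrix_matrix_mult_def diagonal_matrix_def
          if_distrib[of "\<lambda>x. _ * x"] sum.delta cong: if_cong)
        (simp add: scaleR_conv_of_real mult.commute)
    finally show ?thesis .
  qed
  then have "A ** Q = Q ** diagonal_matrix (\<lambda>j. of_real (d j))"
    by (simp add: vec_eq_iff)
  then have "A = Q ** diagonal_matrix (\<lambda>j. of_real (d j)) ** conj_transpose Q"
    by (metis Q' matrix_mul_assoc matrix_mul_rid)
  with Q show ?thesis by (rule that)
qed

section \<open>Functions of a unitarily diagonalized matrix\<close>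

text \<open>For unitary \<open>Q\<close>, the matrix with eigenvalues \<open>d j\<close> on the
  columns of \<open>Q\<close>. Functions of one diagonalized matrix share \<open>Q\<close> and
  differ only in \<open>d\<close>.\<close>

definition spectral_matrix :: "complex^'m^'m \<Rightarrow> ('m \<Rightarrow> complex) \<Rightarrow> complex^'m^'m" where
  "spectral_matrix Q d = Q ** diagonal_matrix d ** conj_transpose Q"

lemma spectral_matrix_nth:
  "spectral_matrix Q d $ i $ l = (\<Sum>j\<in>UNIV. Q $ i $ j * d j * cnj (Q $ l $ j))"
  by (simp add: spectral_matrix_def matrix_matrix_mult_def diagonal_matrix_def
      if_distrib[of "\<lambda>x. _ * x"] sum.delta cong: if_cong)

lemma spectral_matrix_diff:
  "spectral_matrix Q d - spectral_matrix Q e = spectral_matrix Q (\<lambda>j. d j - e j)"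
  by (simp add: vec_eq_iff spectral_matrix_nth algebra_simps sum_subtractf)

lemma spectral_matrix_scaleR:
  "r *\<^sub>R spectral_matrix Q d = spectral_matrix Q (\<lambda>j. of_real r * d j)"
  by (simp add: vec_eq_iff spectral_matrix_nth scaleR_sum_right)
    (simp add: scaleR_conv_of_real mult_ac)

lemma spectral_matrix_sum:
  "(\<Sum>k\<in>K. spectral_matrix Q (d k)) = spectral_matrix Q (\<lambda>j. \<Sum>k\<in>K. d k j)"
proof (rule vec_eq_iff[THEN iffD2], rule allI, rule vec_eq_iff[THEN iffD2], rule allI)
  fix i l
  have "(\<Sum>k\<in>K. spectral_matrix Q (d k)) $ i $ l =
      (\<Sum>k\<in>K. \<Sum>j\<in>UNIV. Q $ i $ j * d k j * cnj (Q $ l $ j))"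
    by (simp add: spectral_matrix_nth)
  also have "\<dots> = (\<Sum>j\<in>UNIV. \<Sum>k\<in>K. Q $ i $ j * d k j * cnj (Q $ l $ j))"
    by (rule sum.swap)
  also have "\<dots> = spectral_matrix Q (\<lambda>j. \<Sum>k\<in>K. d k j) $ i $ l"
    by (simp add: spectral_matrix_nth sum_distrib_left sum_distrib_right)
  finally show "(\<Sum>k\<in>K. spectral_matrix Q (d k)) $ i $ l =
      spectral_matrix Q (\<lambda>j. \<Sum>k\<in>K. d k j) $ i $ l" .
qed

lemma conj_transpose_spectral_matrix:
  "conj_transpose (spectral_matrix Q d) = spectral_matrix Q (\<lambda>j. cnj (d j))"
  by (simp add: vec_eq_iff spectral_matrix_nth mult_ac)

lemma sums_spectral_matrix:
  assumes "\<And>j. (\<lambda>k. d k j) sums e j"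
  shows "(\<lambda>k. spectral_matrix Q (d k)) sums spectral_matrix Q e"
proof -
  have "(\<lambda>N. spectral_matrix Q (\<lambda>j. \<Sum>k<N. d k j) $ i $ l) \<longlonglongrightarrow> spectral_matrix Q e $ i $ l" for i l
    unfolding spectral_matrix_nth using assms unfolding sums_def by (intro tendsto_intros)
  then show ?thesis
    unfolding sums_def spectral_matrix_sum by (intro vec_tendstoI)
qed

text \<open>Each entry is a fixed linear combination of the finitely many \<open>d t j\<close>, so
  scalar estimates on the eigenvalues carry over to the Frobenius norm.\<close>

lemma norm_spectral_matrix_bigo:
  assumes "\<And>j. (\<lambda>t. cmod (d t j)) \<in> O[F](g)"
  shows "(\<lambda>t. norm (spectral_matrix Q (d t))) \<in> O[F](g)"
proof -
  define b where "b t = (\<Sum>i\<in>UNIV. \<Sum>l\<in>UNIV. \<Sum>j\<in>UNIV.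
      cmod (Q $ i $ j) * cmod (d t j) * cmod (Q $ l $ j))" for t
  have "norm (spectral_matrix Q (d t)) \<le> b t" for t
  proof -
    have "norm (spectral_matrix Q (d t)) \<le>
        (\<Sum>i\<in>UNIV. norm (spectral_matrix Q (d t) $ i))"
      by (simp add: norm_vec_def L2_set_le_sum)
    also have "\<dots> \<le> (\<Sum>i\<in>UNIV. \<Sum>l\<in>UNIV. cmod (spectral_matrix Q (d t) $ i $ l))"
      by (intro sum_mono) (simp add: norm_vec_def L2_set_le_sum)
    also have "\<dots> \<le> b t"
      unfolding b_def spectral_matrix_nth
      by (intro sum_mono order_trans[OF norm_sum]) (simp add: norm_mult)
    finally show ?thesis .
  qed
  then have "(\<lambda>t. norm (spectral_matrix Q (d t))) \<in> O[F](b)"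
    by (intro landau_o.big_mono always_eventually allI) (simp add: order_trans[OF _ abs_ge_self])
  moreover have "b \<in> O[F](g)"
    unfolding b_def using assms by (intro big_sum_in_bigo) simp
  ultimately show ?thesis
    by (rule landau_o.big_trans)
qed

section \<open>Functional calculus for a unitary \<open>Q\<close>\<close>

context
  fixes Q :: "complex^'m^'m"
  assumes Q: "conj_transpose Q ** Q = mat 1"
begin

lemma spectral_matrix_mult:
  "spectral_matrix Q d ** spectral_matrix Q e = spectral_matrix Q (\<lambda>j. d j * e j)"
proof -
  have "spectral_matrix Q d ** spectral_matrix Q e =
      Q ** diagonal_matrix d ** (conj_transpose Q ** Q) ** diagonal_matrix e ** conj_transpose Q"
    unfolding spectral_matrix_def by (simp only: matrix_mul_assoc)
  also have "\<dots> = Q ** (diagonal_matrix d ** diagonal_matrix e) ** conj_transpose Q"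
    by (simp add: Q matrix_mul_assoc)
  also have "diagonal_matrix d ** diagonal_matrix e = diagonal_matrix (\<lambda>j. d j * e j)"
    by (simp add: vec_eq_iff diagonal_matrix_def matrix_matrix_mult_def
        if_distrib[of "\<lambda>x. _ * x"] sum.delta cong: if_cong)
  finally show ?thesis
    by (simp add: spectral_matrix_def)
qed

lemma spectral_matrix_1: "spectral_matrix Q (\<lambda>_. 1) = mat 1"
proof -
  have "diagonal_matrix (\<lambda>_ :: 'm. 1) = mat 1"
    by (simp add: diagonal_matrix_def mat_def)
  moreover have "Q ** conj_transpose Q = mat 1"
    using Q by (simp add: matrix_left_right_inverse)
  ultimately show ?thesis
    by (simp add: spectral_matrix_def)
qed

lemma matrix_power_spectral_matrix:
  "matrix_power (spectral_matrix Q d) k = spectral_matrix Q (\<lambda>j. d j ^ k)"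
  by (induction k) (simp_all add: spectral_matrix_1 spectral_matrix_mult)

lemma Theta_spectral_matrix:
  "Theta n (spectral_matrix Q d) = spectral_matrix Q (\<lambda>j. Theta_scalar n (d j))"
  unfolding Theta_def Theta_scalar_def
  by (simp add: spectral_matrix_scaleR matrix_power_spectral_matrix spectral_matrix_sum
      Theta_coeff_def)

lemma matrix_exp_spectral_matrix:
  "matrix_exp (spectral_matrix Q d) = spectral_matrix Q (\<lambda>j. exp (d j))"
proof -
  have "(\<lambda>k. spectral_matrix Q (\<lambda>j. of_real (inverse (fact k)) * d j ^ k)) sums
      spectral_matrix Q (\<lambda>j. exp (d j))"
    using exp_converges[where 'a = complex]
    by (intro sums_spectral_matrix) (simp add: scaleR_conv_of_real)
  then show ?thesis
    unfolding matrix_exp_def matrix_power_spectral_matrix spectral_matrix_scaleR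
    by (rule sums_unique[symmetric])
qed

lemma invertible_spectral_matrix:
  assumes "\<And>j. d j \<noteq> 0"
  shows "invertible (spectral_matrix Q d)"
  unfolding invertible_def
  using assms by (intro exI[of _ "spectral_matrix Q (\<lambda>j. inverse (d j))"])
    (simp add: spectral_matrix_mult spectral_matrix_1)

text \<open>The matrix is \<open>S ** S\<close> for the Hermitian \<open>S\<close> with eigenvalues
  \<open>sqrt (r j)\<close>, so its form at \<open>x\<close> is the squared norm of
  \<open>S *v x\<close>, positive because \<open>S\<close> is invertible.\<close>

lemma hermitian_pos_def_spectral_matrix:
  fixes r :: "'m \<Rightarrow> real"
  assumes "\<And>j. 0 < r j"
  shows "hermitian_pos_def (spectral_matrix Q (\<lambda>j. of_real (r j)))"
proof -
  define S where "S = spectral_matrix Q (\<lambda>j. of_real (sqrt (r j)))"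
  have S: "conj_transpose S = S"
    by (simp add: S_def conj_transpose_spectral_matrix)
  have SS: "S ** S = spectral_matrix Q (\<lambda>j. of_real (r j))"
    using assms by (simp add: S_def spectral_matrix_mult less_imp_le flip: of_real_mult)
  have "sqrt (r j) \<noteq> 0" for j
    using assms[of j] by simp
  then have "invertible S"
    unfolding S_def by (intro invertible_spectral_matrix) simp
  then have inj: "S *v x \<noteq> 0" if "x \<noteq> 0" for x
    using that by (metis invertible_def matrix_vector_mul_assoc matrix_vector_mul_lid
        matrix_vector_mult_0_right)
  have "0 < x \<bullet> ((S ** S) *v x)" if "x \<noteq> 0" for x
  proof -
    have "x \<bullet> ((S ** S) *v x) = (S *v x) \<bullet> (S *v x)"
      using cinner_matrix_left[of S x "S *v x"]
      by (simp add: S matrix_vector_mul_assoc flip: Re_cinner)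
    then show ?thesis
      using inj[OF that] by simp
  qed
  moreover have "hermitian (S ** S)"
    by (simp add: hermitian_def conj_transpose_mult S)
  ultimately show ?thesis
    by (simp add: hermitian_pos_def_iff SS)
qed

text \<open>The scalar polar form \<open>d = sgn d * cmod d\<close> is applied to each
  eigenvalue.\<close>

lemma polar_factor_spectral_matrix:
  assumes "\<And>j. d j \<noteq> 0"
  shows "polar_factor (spectral_matrix Q d) = spectral_matrix Q (\<lambda>j. sgn (d j))"
proof (rule polar_factor_eqI)
  have "cnj (sgn (d j)) * sgn (d j) = 1" for j
    using complex_norm_square[of "sgn (d j)"] assms[of j] by (simp add: norm_sgn mult.commute)
  moreover have "sgn (d j) * of_real (cmod (d j)) = d j" for j
    using assms[of j] by (simp add: sgn_div_norm scaleR_conv_of_real)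
  ultimately show "is_polar_decomp (spectral_matrix Q d) (spectral_matrix Q (\<lambda>j. sgn (d j)))
      (spectral_matrix Q (\<lambda>j. of_real (cmod (d j))))"
    using assms unfolding is_polar_decomp_def
    by (simp add: conj_transpose_spectral_matrix spectral_matrix_mult spectral_matrix_1
        hermitian_pos_def_spectral_matrix)
qed

end

section \<open>Skew-Hermitian matrices and the final estimate\<close>

lemma skew_hermitian_spectral:
  fixes A :: "complex^'m^'m"
  assumes "skew_hermitian A"
  obtains Q and r :: "'m \<Rightarrow> real" where "conj_transpose Q ** Q = mat 1"
    "A = spectral_matrix Q (\<lambda>j. \<i> * r j)"
proof -
  \<comment> \<open>Multiplication by \<open>- \<i>\<close> turns a skew-Hermitian matrix into a
    Hermitian one with real spectrum.\<close>
  define B where "B = map_matrix ((*) (- \<i>)) A"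
  have A: "A = map_matrix ((*) \<i>) B"
    by (simp add: B_def vec_eq_iff)
  have "cnj (A $ j $ i) = - A $ i $ j" for i j
    using assms by (metis conj_transpose_nth skew_hermitian_def vector_uminus_component)
  then have "hermitian B"
    by (simp add: hermitian_def B_def vec_eq_iff)
  then obtain Q and r :: "'m \<Rightarrow> real" where Q: "conj_transpose Q ** Q = mat 1"
    and B: "B = spectral_matrix Q (\<lambda>j. of_real (r j))"
    unfolding spectral_matrix_def by (rule hermitian_spectral)
  have "A = spectral_matrix Q (\<lambda>j. \<i> * r j)"
    unfolding A B by (simp add: vec_eq_iff spectral_matrix_nth sum_distrib_left mult_ac)
  with Q show ?thesis by (rule that)
qed

theorem theorem2p1:
  fixes \<Omega> :: "complex^'m^'m" and n :: nat
  assumes "skew_hermitian \<Omega>"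
  shows "(\<forall>\<^sub>F t::real in at 0. invertible (Theta n (t *\<^sub>R \<Omega>))) \<and>
    (\<lambda>t::real. norm (polar_factor (Theta n (t *\<^sub>R \<Omega>)) - matrix_exp (t *\<^sub>R \<Omega>)))
      \<in> O[at 0](\<lambda>t. t ^ (2 * n + 1))"
proof -
  obtain Q and r :: "'m \<Rightarrow> real" where Q: "conj_transpose Q ** Q = mat 1"
    and \<Omega>: "\<Omega> = spectral_matrix Q (\<lambda>j. \<i> * r j)"
    using skew_hermitian_spectral[OF assms] .
  define z :: "real \<Rightarrow> 'm \<Rightarrow> complex" where "z t j = of_real t * (\<i> * r j)" for t j
  define \<theta> where "\<theta> t j = Theta_scalar n (z t j)" for t j
  have scaled: "t *\<^sub>R \<Omega> = spectral_matrix Q (z t)" for t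
    by (simp add: \<Omega> spectral_matrix_scaleR z_def[abs_def])
  have Theta: "Theta n (t *\<^sub>R \<Omega>) = spectral_matrix Q (\<theta> t)" for t
    by (simp add: scaled Theta_spectral_matrix[OF Q] \<theta>_def[abs_def])
  have "eventually (\<lambda>t. \<theta> t j \<noteq> 0) (at 0)" for j
  proof -
    have "((\<lambda>t. z t j) \<longlongrightarrow> 0) (at 0)"
      unfolding z_def by (auto intro!: tendsto_eq_intros)
    from tendsto_Theta_scalar[OF this, of n] show ?thesis
      unfolding \<theta>_def by (rule tendsto_imp_eventually_ne) simp
  qed
  \<comment> \<open>There are finitely many eigenvalues, so one neighbourhood of \<open>0\<close>
    serves for all of them.\<close>
  then have nz: "eventually (\<lambda>t. \<forall>j. \<theta> t j \<noteq> 0) (at 0)"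
    by (intro eventually_all_finite) auto
  define e where "e t j = sgn (\<theta> t j) - exp (z t j)" for t j
  have "(\<lambda>t. norm (spectral_matrix Q (e t))) \<in> O[at 0](\<lambda>t. t ^ (2 * n + 1))"
    unfolding e_def \<theta>_def z_def by (intro norm_spectral_matrix_bigo sgn_Theta_scalar_bigo)
  \<comment> \<open>The identity is claimed only near \<open>0\<close>, where no
    \<open>\<theta> t j\<close> vanishes and the polar factor is determined; this suffices for the
    Landau symbol.\<close>
  moreover have "eventually (\<lambda>t. norm (polar_factor (Theta n (t *\<^sub>R \<Omega>)) - matrix_exp (t *\<^sub>R \<Omega>)) =
      norm (spectral_matrix Q (e t))) (at 0)"
    using nz by eventually_elim
      (simp only: Theta, simp add: scaled polar_factor_spectral_matrix[OF Q]
        matrix_exp_spectral_matrix[OF Q] spectral_matrix_diff e_def[abs_def])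
  ultimately have "(\<lambda>t. norm (polar_factor (Theta n (t *\<^sub>R \<Omega>)) - matrix_exp (t *\<^sub>R \<Omega>)))
      \<in> O[at 0](\<lambda>t. t ^ (2 * n + 1))"
    by (subst landau_o.big.in_cong)
  moreover have "eventually (\<lambda>t. invertible (Theta n (t *\<^sub>R \<Omega>))) (at 0)"
    using nz by eventually_elim (simp add: Theta invertible_spectral_matrix[OF Q])
  ultimately show ?thesis by blast
qed

end
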